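(* Consider a general $p$-value family $(p_i(X))_{1\le i\le m}$, a (possibly data-dependent) template $t_k(\lambda)$, $\lambda\in[0,1]$, $1\leq k\leq K$, with associated reference families $\mathfrak{R}_\lambda$, and any $\lambda$-calibration $\lambda(\cdot,\cdot)$ for this template. Let $\alpha\in(0,1)$ and let $\widehat{A}\subset\mathbb{N}_m$ be the output of the following step-down algorithm: set $A^{(0)}=\mathbb{N}_m$; for $j=1,2,\dots$ set $\lambda_j=\lambda(\alpha,A^{(j-1)})$ and $A^{(j)}=\{i\in\mathbb{N}_m:\ p_i(X)\geq t_1(\lambda_j)\}$; stop at the first $j\ge1$ such that $A^{(j)}=A^{(j-1)}$ and return $\widehat{A}=A^{(j)}$. Then the procedure $\mathfrak{R}_{\lambda(\alpha,\widehat{A})}$ controls the JER at level $\alpha$, that is, $$\forall P\in\mathcal{P},\qquad \mathrm{JER}(\mathfrak{R}_{\lambda(\alpha,\widehat{A})},P)\leq\alpha.$$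
   Context: $X$ is an observation with distribution $P$ belonging to a statistical model $\mathcal{P}$; $\mathbb{N}_m=\{1,\dots,m\}$ indexes null hypotheses $H_{0,i}\subset\mathcal{P}$; $\mathcal{H}_0=\mathcal{H}_0(P)=\{i\in\mathbb{N}_m: P\in H_{0,i}\}$ and $m_0=m_0(P)=|\mathcal{H}_0(P)|$. For each $i$, $p_i(X)\in[0,1]$ is a $p$-value for $H_{0,i}$. For $A\subset\mathbb{N}_m$ and $1\le k\le|A|$, $p_{(k:A)}(X)$ is the $k$-th smallest value among $\{p_i(X), i\in A\}$. Minima over an empty index set equal $+\infty$; $a\wedge b=\min(a,b)$. Template: a family of functions $t_k(\lambda)$, $\lambda\in[0,1]$, $1\leq k\leq K$ (possibly depending on $X$), with $K\in\{1,\dots,m\}$ fixed, such that for all $k$, $t_k(0)=0$ and $t_k(\cdot)$ is non-decreasing and left-continuous on $[0,1]$. Generalized inverse: $t_k^{-1}(y)=\max\{x\in[0,1]: t_k(x)\leq y\}$. Reference family: for $\lambda\in[0,1]$ (possibly data-dependent), $\mathfrak{R}_\lambda=(R_1(X),\dots,R_K(X))$ with $R_k(X)=\{i\in\mathbb{N}_m: p_i(X)<t_k(\lambda)\}$. The joint family-wise error rate of a family $\mathfrak{R}=(R_1(X),\dots,R_K(X))$ is $$\mathrm{JER}(\mathfrak{R},P)=1-\mathbb{P}_{X\sim P}\big(\forall k\in\{1,\dots,K\}:\ |R_k(X)\cap\mathcal{H}_0(P)|\leq k-1\big).$$ $\lambda$-calibration: a (possibly data-dependent) functional $\lambda(\alpha,A)\in[0,1]$,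 $\alpha\in(0,1)$, $A\subset\mathbb{N}_m$, such that (i) for all $\alpha\in(0,1)$ and $A\subset A'\subset\mathbb{N}_m$, $\lambda(\alpha,A')\leq\lambda(\alpha,A)$; and (ii) for all $\alpha\in(0,1)$ and $P\in\mathcal{P}$, $$\mathbb{P}_{X\sim P}\Big(\min_{1\leq k\leq K\wedge m_0}\big\{t_k^{-1}\big(p_{(k:\mathcal{H}_0(P))}(X)\big)\big\}<\lambda(\alpha,\mathcal{H}_0(P))\Big)\leq\alpha.$$ *)

theory Defs
  imports "HOL-Probability.Probability"
begin

(* The observation X is the identity on the sample space S, so a law P in the model is the
   distribution of X, and a function of the data is a function on S (the data is always the
   last argument).  All data-dependent quantities are assumed to be measurable. *)

definition statistical_model :: "'x measure \<Rightarrow> 'x measure set \<Rightarrow> bool" where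
  "statistical_model S \<P> \<longleftrightarrow> (\<forall>P\<in>\<P>. prob_space P \<and> sets P = sets S)"

definition true_nulls :: "nat \<Rightarrow> (nat \<Rightarrow> 'x measure set) \<Rightarrow> 'x measure \<Rightarrow> nat set" where
  "true_nulls m H0 P = {i \<in> {1..m}. P \<in> H0 i}"

definition p_value :: "'x measure \<Rightarrow> 'x measure set \<Rightarrow> ('x \<Rightarrow> real) \<Rightarrow> bool" where
  "p_value S H q \<longleftrightarrow>
     q \<in> borel_measurable S \<and> (\<forall>x\<in>space S. q x \<in> {0..1}) \<and>
     (\<forall>P\<in>H. \<forall>u\<in>{0..1}. measure P {x \<in> space P. q x \<le> u} \<le> u)"

definition kth_smallest :: "nat \<Rightarrow> nat set \<Rightarrow> (nat \<Rightarrow> real) \<Rightarrow> real" where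
  "kth_smallest k A v = sort (map v (sorted_list_of_set A)) ! (k - 1)"

definition template :: "'x measure \<Rightarrow> nat \<Rightarrow> (nat \<Rightarrow> real \<Rightarrow> 'x \<Rightarrow> real) \<Rightarrow> bool" where
  "template S K t \<longleftrightarrow>
     (\<forall>k\<in>{1..K}.
        (\<forall>u\<in>{0..1}. t k u \<in> borel_measurable S) \<and>
        (\<forall>x\<in>space S.
           t k 0 x = 0 \<and>
           mono_on {0..1} (\<lambda>u. t k u x) \<and>
           (\<forall>u\<in>{0<..1}. continuous (at_left u) (\<lambda>u. t k u x))))"

(* The maximum is attained for every y \<ge> 0 when f is a template function. *)
definition gen_inverse :: "(real \<Rightarrow> real) \<Rightarrow> real \<Rightarrow> real" where
  "gen_inverse f y = (GREATEST u. u \<in> {0..1} \<and> f u \<le> y)"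

definition reference_family ::
  "nat \<Rightarrow> (nat \<Rightarrow> 'x \<Rightarrow> real) \<Rightarrow> (nat \<Rightarrow> real \<Rightarrow> 'x \<Rightarrow> real) \<Rightarrow> ('x \<Rightarrow> real) \<Rightarrow> nat \<Rightarrow> 'x \<Rightarrow> nat set" where
  "reference_family m p t l k x = {i \<in> {1..m}. p i x < t k (l x) x}"

definition JER ::
  "nat \<Rightarrow> (nat \<Rightarrow> 'x measure set) \<Rightarrow> nat \<Rightarrow> (nat \<Rightarrow> 'x \<Rightarrow> nat set) \<Rightarrow> 'x measure \<Rightarrow> real" where
  "JER m H0 K R P =
     1 - measure P {x \<in> space P. \<forall>k\<in>{1..K}. card (R k x \<inter> true_nulls m H0 P) \<le> k - 1}"

(* The minimum is taken in the extended reals, where the infimum of the empty set is \<infinity>. *)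
definition calibration ::
  "'x measure \<Rightarrow> 'x measure set \<Rightarrow> nat \<Rightarrow> (nat \<Rightarrow> 'x measure set) \<Rightarrow> (nat \<Rightarrow> 'x \<Rightarrow> real) \<Rightarrow>
   nat \<Rightarrow> (nat \<Rightarrow> real \<Rightarrow> 'x \<Rightarrow> real) \<Rightarrow> (real \<Rightarrow> nat set \<Rightarrow> 'x \<Rightarrow> real) \<Rightarrow> bool" where
  "calibration S \<P> m H0 p K t lam \<longleftrightarrow>
     (\<forall>\<alpha>\<in>{0<..<1}. \<forall>A. A \<subseteq> {1..m} \<longrightarrow>
        lam \<alpha> A \<in> borel_measurable S \<and> (\<forall>x\<in>space S. lam \<alpha> A x \<in> {0..1})) \<and>
     (\<forall>\<alpha>\<in>{0<..<1}. \<forall>A A'. A \<subseteq> A' \<and> A' \<subseteq> {1..m} \<longrightarrow>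
        (\<forall>x\<in>space S. lam \<alpha> A' x \<le> lam \<alpha> A x)) \<and>
     (\<forall>\<alpha>\<in>{0<..<1}. \<forall>P\<in>\<P>.
        measure P {x \<in> space P.
          (INF k\<in>{1..min K (card (true_nulls m H0 P))}.
             ereal (gen_inverse (\<lambda>u. t k u x) (kth_smallest k (true_nulls m H0 P) (\<lambda>i. p i x))))
          < ereal (lam \<alpha> (true_nulls m H0 P) x)} \<le> \<alpha>)"

primrec step_down_iter ::
  "nat \<Rightarrow> (nat \<Rightarrow> 'x \<Rightarrow> real) \<Rightarrow> (nat \<Rightarrow> real \<Rightarrow> 'x \<Rightarrow> real) \<Rightarrow> (nat set \<Rightarrow> 'x \<Rightarrow> real) \<Rightarrow>
   nat \<Rightarrow> 'x \<Rightarrow> nat set" where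
  "step_down_iter m p t l 0 x = {1..m}"
| "step_down_iter m p t l (Suc j) x =
     {i \<in> {1..m}. p i x \<ge> t 1 (l (step_down_iter m p t l j x) x) x}"

definition step_down ::
  "nat \<Rightarrow> (nat \<Rightarrow> 'x \<Rightarrow> real) \<Rightarrow> (nat \<Rightarrow> real \<Rightarrow> 'x \<Rightarrow> real) \<Rightarrow> (nat set \<Rightarrow> 'x \<Rightarrow> real) \<Rightarrow>
   'x \<Rightarrow> nat set" where
  "step_down m p t l x = step_down_iter m p t l
     (LEAST j. j \<ge> 1 \<and> step_down_iter m p t l j x = step_down_iter m p t l (j - 1) x) x"

text \<open>Under the assumptions above the iterates decrease, so the stopping index exists.\<close>

lemma step_down_stops:
  assumes t: "template S K t" and K: "K \<ge> 1"
    and lam: "calibration S \<P> m H0 p K t lam" and \<alpha>: "\<alpha> \<in> {0<..<1}" and x: "x \<in> space S"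
  shows "\<exists>j\<ge>1. step_down_iter m p t (lam \<alpha>) j x = step_down_iter m p t (lam \<alpha>) (j - 1) x"
proof -
  let ?A = "\<lambda>j. step_down_iter m p t (lam \<alpha>) j x"
  have sub: "?A j \<subseteq> {1..m}" for j by (cases j) auto
  have mono: "mono_on {0..1} (\<lambda>u. t 1 u x)" using t K x by (auto simp: template_def)
  have rng: "lam \<alpha> A x \<in> {0..1}" if "A \<subseteq> {1..m}" for A
    using lam[unfolded calibration_def, THEN conjunct1, rule_format, OF \<alpha> that] x by blast
  have anti: "lam \<alpha> A' x \<le> lam \<alpha> A x" if "A \<subseteq> A'" "A' \<subseteq> {1..m}" for A A'
    using lam[unfolded calibration_def, THEN conjunct2, THEN conjunct1, rule_format,
      OF \<alpha> conjI[OF that] x] .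
  have dec: "?A (Suc j) \<subseteq> ?A j" for j
  proof (induction j)
    case 0
    show ?case by auto
  next
    case (Suc j)
    have "t 1 (lam \<alpha> (?A j) x) x \<le> t 1 (lam \<alpha> (?A (Suc j)) x) x"
      by (rule mono_onD[OF mono rng[OF sub] rng[OF sub] anti[OF Suc sub]])
    then show ?case unfolding step_down_iter.simps(2) by (blast intro: order_trans)
  qed
  show ?thesis
  proof (rule ccontr)
    assume "\<not> ?thesis"
    then have "?A (Suc j) \<noteq> ?A j" for j by (auto dest: spec[of _ "Suc j"] simp del: step_down_iter.simps)
    with dec have less: "card (?A (Suc j)) < card (?A j)" for j
      by (intro psubset_card_mono psubsetI finite_subset[OF sub finite_atLeastAtMost])
    have "card (?A j) + j \<le> m" for j
    proof (induction j)
      case 0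
      show ?case by simp
    next
      case (Suc j)
      with less[of j] show ?case by linarith
    qed
    from this[of "Suc m"] show False by simp
  qed
qed

end

theory Submission
  imports Defs
begin

text \<open>
  Fix a law \<open>P\<close> and let \<open>A\<close> be its set of true nulls. Call a parameter good at a data point if
  every \<open>R\<^sub>k\<close> built from it contains at most \<open>k - 1\<close> elements of \<open>A\<close>. Since
  \<open>t\<^sub>k\<^sup>-\<^sup>1(y) < \<lambda>\<close> iff \<open>y < t\<^sub>k(\<lambda>)\<close> for \<open>y \<ge> 0\<close>
  (\<open>gen_inverse_less_iff\<close>), and the \<open>k\<close>-th smallest value lies below a
  threshold iff at least \<open>k\<close> values do (\<open>kth_smallest_less_iff\<close>), the event whose probability a
  calibration bounds by \<open>\<alpha>\<close> is exactly that \<open>\<lambda>(\<alpha>, A)\<close> is not good (\<open>INF_gen_inverse_less_iff\<close>).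

  When \<open>\<lambda>(\<alpha>, A)\<close> is good, its \<open>R\<^sub>1\<close> misses \<open>A\<close>. By induction every iterate of the step-down
  algorithm then contains \<open>A\<close> (\<open>subset_step_down_iter\<close>): a larger set has a smaller parameter,
  hence a smaller \<open>R\<^sub>1\<close>, which still misses \<open>A\<close>. So the output contains \<open>A\<close>, its parameter is
  at most \<open>\<lambda>(\<alpha>, A)\<close>, and by monotonicity of the template it is good as well.

  The comparison of probabilities requires that being good is an event for the data-dependent
  parameter of the step-down output. This rests on left continuity of the template
  (\<open>measurable_rejected\<close>) and on the output taking finitely many values
  (\<open>measurable_step_down\<close>).
\<close>

section \<open>Order statistics and generalized inverses\<close>

lemma sorted_nth_less_iff:
  fixes s :: "'a::linorder"
  assumes "sorted xs" "n < length xs"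
  shows "xs ! n < s \<longleftrightarrow> n < length (filter (\<lambda>y. y < s) xs)"
  using assms
proof (induction xs arbitrary: n)
  case (Cons a xs)
  show ?case
  proof (cases "a < s")
    case True
    with Cons show ?thesis by (cases n) auto
  next
    case False
    with Cons.prems have "\<not> y < s" if "y \<in> set (a # xs)" for y
      using that by auto
    then have "filter (\<lambda>y. y < s) (a # xs) = []" "\<not> (a # xs) ! n < s"
      using nth_mem[OF Cons.prems(2)] by (auto simp: filter_empty_conv)
    then show ?thesis by simp
  qed
qed simp

lemma kth_smallest_less_iff:
  assumes "finite A" "1 \<le> k" "k \<le> card A"
  shows "kth_smallest k A v < s \<longleftrightarrow> k \<le> card {i \<in> A. v i < s}"
proof -
  let ?L = "sorted_list_of_set A"
  have "kth_smallest k A v < s \<longleftrightarrow>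
      k - 1 < length (filter (\<lambda>y. y < s) (sort (map v ?L)))"
    unfolding kth_smallest_def using assms by (intro sorted_nth_less_iff) auto
  also have "length (filter (\<lambda>y. y < s) (sort (map v ?L))) = length (filter (\<lambda>i. v i < s) ?L)"
    by (simp add: filter_sort filter_map o_def)
  also have "\<dots> = card {i \<in> A. v i < s}"
    using distinct_card[of "filter (\<lambda>i. v i < s) ?L"] assms(1) by simp
  finally show ?thesis using assms by auto
qed

lemma kth_smallest_nonneg:
  assumes "finite A" "1 \<le> k" "k \<le> card A" "\<And>i. i \<in> A \<Longrightarrow> 0 \<le> v i"
  shows "0 \<le> kth_smallest k A v"
proof -
  have none: "{i \<in> A. v i < 0} = {}" using assms(4) by force
  show ?thesis using kth_smallest_less_iff[OF assms(1-3), of v 0] assms(2) unfolding none by simp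
qed

text \<open>Left continuity makes the maximum in the definition of the generalized inverse attained, at
  the supremum \<open>s\<close> of the sublevel set; the rest is monotonicity.\<close>

lemma gen_inverse_less_iff:
  fixes f :: "real \<Rightarrow> real"
  assumes mono: "mono_on {0..1} f" and zero: "f 0 = 0"
    and left: "\<And>u. u \<in> {0<..1} \<Longrightarrow> continuous (at_left u) f"
    and y: "0 \<le> y" and l: "l \<in> {0..1}"
  shows "gen_inverse f y < l \<longleftrightarrow> y < f l"
proof -
  define U where "U = {u \<in> {0..1}. f u \<le> y}"
  define s where "s = Sup U"
  have U0: "0 \<in> U" using y zero by (simp add: U_def)
  have bdd: "bdd_above U" by (auto simp: U_def intro!: bdd_aboveI[of _ 1])
  have s_ub: "u \<le> s" if "u \<in> U" for u
    unfolding s_def using that bdd by (rule cSup_upper)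
  have s01: "s \<in> {0..1}"
    using s_ub[OF U0] U0 by (auto simp: s_def U_def intro!: cSup_least)
  have below: "f u \<le> y" if "0 \<le> u" "u < s" for u
  proof -
    from \<open>u < s\<close> obtain w where w: "w \<in> U" "u < w"
      using U0 bdd unfolding s_def using less_cSup_iff[of U u] by blast
    then have "f u \<le> f w" using that mono by (intro mono_onD[of "{0..1}" f]) (auto simp: U_def)
    with w show ?thesis by (auto simp: U_def)
  qed
  have fs: "f s \<le> y"
  proof (cases "s = 0")
    case True
    with zero y show ?thesis by simp
  next
    case False
    with s01 have pos: "0 < s" by simp
    have lim: "(f \<longlongrightarrow> f s) (at_left s)"
      using left[of s] s01 pos by (simp add: continuous_within)
    have "eventually (\<lambda>u. f u \<le> y) (at_left s)"
      unfolding eventually_at_left[OF pos] using below pos by (intro exI[of _ 0]) auto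
    then show ?thesis
      by (rule tendsto_upperbound[OF lim]) simp
  qed
  have inv: "gen_inverse f y = s"
    unfolding gen_inverse_def
    by (rule Greatest_equality) (use fs s01 s_ub in \<open>auto simp: U_def\<close>)
  show ?thesis
  proof
    assume "gen_inverse f y < l"
    with inv have "\<not> l \<le> s" by simp
    then have "l \<notin> U" using s_ub by blast
    with l show "y < f l" by (simp add: U_def)
  next
    assume "y < f l"
    moreover have "f l \<le> f s" if "l \<le> s"
      using that mono s01 l by (intro mono_onD[of "{0..1}" f]) auto
    ultimately show "gen_inverse f y < l" using fs inv by force
  qed
qed

text \<open>A monotone left-continuous function exceeds a nonnegative level at \<open>l\<close> iff it does so at a rational
  point before \<open>l\<close>. At \<open>l = 0\<close> both sides fail, as \<open>f 0 = 0\<close>.\<close>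

lemma less_left_continuous_iff_rat:
  fixes f :: "real \<Rightarrow> real"
  assumes mono: "mono_on {0..1} f" and zero: "f 0 = 0"
    and left: "\<And>u. u \<in> {0<..1} \<Longrightarrow> continuous (at_left u) f"
    and y: "0 \<le> y" and l: "l \<in> {0..1}"
  shows "y < f l \<longleftrightarrow> (\<exists>q\<in>\<rat> \<inter> {0..1}. q < l \<and> y < f q)"
proof
  assume less: "y < f l"
  with gen_inverse_less_iff[OF assms] have "gen_inverse f y < l" by simp
  moreover have "l \<noteq> 0" using less zero y by auto
  ultimately have "max 0 (gen_inverse f y) < l" using l by auto
  from Rats_dense_in_real[OF this] obtain q where
    q: "q \<in> \<rat>" "max 0 (gen_inverse f y) < q" "q < l" by blast
  with l have q01: "q \<in> {0..1}" by auto
  have "y < f q" using gen_inverse_less_iff[OF mono zero left y q01] q by simp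
  with q q01 show "\<exists>q\<in>\<rat> \<inter> {0..1}. q < l \<and> y < f q" by blast
next
  assume "\<exists>q\<in>\<rat> \<inter> {0..1}. q < l \<and> y < f q"
  then obtain q where q: "q \<in> {0..1}" "q < l" "y < f q" by blast
  then have "f q \<le> f l" using mono l by (intro mono_onD[of "{0..1}" f]) auto
  with q show "y < f l" by simp
qed

section \<open>Templates and calibrations\<close>

lemma template_at:
  assumes "template S K t" "k \<in> {1..K}" "x \<in> space S"
  shows "mono_on {0..1} (\<lambda>u. t k u x)" "t k 0 x = 0"
    "\<And>u. u \<in> {0<..1} \<Longrightarrow> continuous (at_left u) (\<lambda>u. t k u x)"
  using assms by (auto simp: template_def)

lemma calibration_measurable:
  assumes "calibration S \<P> m H0 p K t lam" "\<alpha> \<in> {0<..<1}" "A \<subseteq> {1..m}"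
  shows "lam \<alpha> A \<in> borel_measurable S"
  using assms(1)[unfolded calibration_def, THEN conjunct1, rule_format, OF assms(2,3)] by blast

lemma calibration_range:
  assumes "calibration S \<P> m H0 p K t lam" "\<alpha> \<in> {0<..<1}" "A \<subseteq> {1..m}" "x \<in> space S"
  shows "lam \<alpha> A x \<in> {0..1}"
  using assms(1)[unfolded calibration_def, THEN conjunct1, rule_format, OF assms(2,3)] assms(4)
  by blast

lemma calibration_antimono:
  assumes "calibration S \<P> m H0 p K t lam" "\<alpha> \<in> {0<..<1}" "A \<subseteq> A'" "A' \<subseteq> {1..m}" "x \<in> space S"
  shows "lam \<alpha> A' x \<le> lam \<alpha> A x"
  using assms(1)[unfolded calibration_def, THEN conjunct2, THEN conjunct1, rule_format,
      OF assms(2) conjI[OF assms(3,4)] assms(5)] .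

section \<open>Measurability of the reference family and of the step-down output\<close>

text \<open>The parameter is random, so measurability of each \<open>t k u\<close> for fixed \<open>u\<close> does not suffice;
  the event is a countable union over rational \<open>u\<close>.\<close>

lemma measurable_rejected:
  assumes t: "template S K t" "k \<in> {1..K}"
    and q: "q \<in> borel_measurable S" "\<And>x. x \<in> space S \<Longrightarrow> 0 \<le> q x"
    and l: "l \<in> borel_measurable S" "\<And>x. x \<in> space S \<Longrightarrow> l x \<in> {0..1}"
  shows "Measurable.pred S (\<lambda>x. q x < t k (l x) x)"
proof -
  have tu: "t k u \<in> borel_measurable S" if "u \<in> {0..1}" for u
    using t that by (auto simp: template_def)
  have "countable (\<rat> \<inter> {0..1::real})"
    using countable_rat by (rule countable_Int1)
  moreover have "Measurable.pred S (\<lambda>x. u < l x \<and> q x < t k u x)" if "u \<in> \<rat> \<inter> {0..1}" for u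
    using that by (intro pred_intros_logic borel_measurable_pred_less) (auto intro: tu q l)
  ultimately have "Measurable.pred S (\<lambda>x. \<exists>u\<in>\<rat> \<inter> {0..1}. u < l x \<and> q x < t k u x)"
    unfolding pred_def by (intro sets.sets_Collect_countable_Ex')
  moreover have "q x < t k (l x) x \<longleftrightarrow> (\<exists>u\<in>\<rat> \<inter> {0..1}. u < l x \<and> q x < t k u x)"
    if "x \<in> space S" for x
    by (rule less_left_continuous_iff_rat[OF template_at[OF t that] q(2)[OF that] l(2)[OF that]])
  ultimately show ?thesis by (subst measurable_cong) auto
qed

lemma measurable_finite_random_set:
  assumes fin: "finite I" and Q: "\<And>i. i \<in> I \<Longrightarrow> Measurable.pred S (\<lambda>x. Q i x)"
  shows "(\<lambda>x. {i \<in> I. Q i x}) \<in> measurable S (count_space (Pow I))"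
proof -
  have "Measurable.pred S (\<lambda>x. {i \<in> I. Q i x} = B)" if "B \<subseteq> I" for B
  proof -
    have "Measurable.pred S (\<lambda>x. \<forall>i\<in>I. Q i x \<longleftrightarrow> i \<in> B)"
      using fin Q by (intro pred_intros_finite pred_intros_logic) auto
    moreover have "{i \<in> I. Q i x} = B \<longleftrightarrow> (\<forall>i\<in>I. Q i x \<longleftrightarrow> i \<in> B)" for x
      using that by blast
    ultimately show ?thesis by simp
  qed
  then show ?thesis
    using fin
    by (subst measurable_count_space_eq2) (auto simp: vimage_def pred_def Int_def conj_commute)
qed

lemma measurable_reference_family:
  assumes t: "template S K t" "k \<in> {1..K}"
    and p: "\<And>i. i \<in> {1..m} \<Longrightarrow> p_value S (H0 i) (p i)"
    and l: "l \<in> borel_measurable S" "\<And>x. x \<in> space S \<Longrightarrow> l x \<in> {0..1}"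
  shows "reference_family m p t l k \<in> measurable S (count_space (Pow {1..m}))"
proof -
  have "Measurable.pred S (\<lambda>x. p i x < t k (l x) x)" if "i \<in> {1..m}" for i
    using p[OF that] by (intro measurable_rejected[OF t _ _ l]) (auto simp: p_value_def)
  then show ?thesis
    unfolding reference_family_def by (intro measurable_finite_random_set) auto
qed

lemma step_down_iter_subset: "step_down_iter m p t l j x \<subseteq> {1..m}"
  by (cases j) auto

lemma step_down_subset: "step_down m p t l x \<subseteq> {1..m}"
  unfolding step_down_def by (rule step_down_iter_subset)

lemma measurable_step_down_iter:
  assumes t: "template S K t" "1 \<le> K"
    and p: "\<And>i. i \<in> {1..m} \<Longrightarrow> p_value S (H0 i) (p i)"
    and l: "\<And>A. A \<subseteq> {1..m} \<Longrightarrow> l A \<in> borel_measurable S"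
      "\<And>A x. A \<subseteq> {1..m} \<Longrightarrow> x \<in> space S \<Longrightarrow> l A x \<in> {0..1}"
  shows "step_down_iter m p t l j \<in> measurable S (count_space (Pow {1..m}))"
proof (induction j)
  case 0
  have "(\<lambda>x. {1..m}) \<in> measurable S (count_space (Pow {1..m}))"
    by (rule measurable_const) simp
  moreover have "step_down_iter m p t l 0 = (\<lambda>x. {1..m})"
    by (rule ext) simp
  ultimately show ?case by (simp only:)
next
  case (Suc j)
  have lj: "(\<lambda>x. l (step_down_iter m p t l j x) x) \<in> borel_measurable S"
    by (rule measurable_compose_countable'[OF _ Suc]) (auto intro!: l countable_finite)
  have "Measurable.pred S (\<lambda>x. p i x < t 1 (l (step_down_iter m p t l j x) x) x)"
    if "i \<in> {1..m}" for i
    using p[OF that] t(2)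
    by (intro measurable_rejected[OF t(1) _ _ _ lj l(2)[OF step_down_iter_subset]])
      (auto simp: p_value_def)
  then have "Measurable.pred S (\<lambda>x. p i x \<ge> t 1 (l (step_down_iter m p t l j x) x) x)"
    if "i \<in> {1..m}" for i
    using that pred_intros_logic(2) by (simp flip: not_less)
  then have "(\<lambda>x. {i \<in> {1..m}. p i x \<ge> t 1 (l (step_down_iter m p t l j x) x) x})
      \<in> measurable S (count_space (Pow {1..m}))"
    by (intro measurable_finite_random_set) auto
  moreover have "step_down_iter m p t l (Suc j) =
      (\<lambda>x. {i \<in> {1..m}. p i x \<ge> t 1 (l (step_down_iter m p t l j x) x) x})"
    by (rule ext) simp
  ultimately show ?case by (simp only:)
qed

lemma measurable_step_down:
  assumes t: "template S K t" "1 \<le> K"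
    and p: "\<And>i. i \<in> {1..m} \<Longrightarrow> p_value S (H0 i) (p i)"
    and l: "\<And>A. A \<subseteq> {1..m} \<Longrightarrow> l A \<in> borel_measurable S"
      "\<And>A x. A \<subseteq> {1..m} \<Longrightarrow> x \<in> space S \<Longrightarrow> l A x \<in> {0..1}"
  shows "step_down m p t l \<in> measurable S (count_space (Pow {1..m}))"
proof -
  let ?A = "step_down_iter m p t l"
  note iter = measurable_step_down_iter[of S K t m H0 p l, OF t p l]
  have is_B: "Measurable.pred S (\<lambda>x. ?A j x = B)" for j B
    by (rule measurable_compose[OF iter]) simp_all
  have "Measurable.pred S (\<lambda>x. \<exists>B\<in>Pow {1..m}. ?A j x = B \<and> ?A (j - 1) x = B)" for j
    using is_B by (intro pred_intros_finite pred_intros_logic) auto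
  moreover have "(\<exists>B\<in>Pow {1..m}. ?A j x = B \<and> ?A (j - 1) x = B) \<longleftrightarrow> ?A j x = ?A (j - 1) x"
    for j x
    using step_down_iter_subset[of m p t l j x] by auto
  ultimately have eq: "Measurable.pred S (\<lambda>x. ?A j x = ?A (j - 1) x)" for j
    by (simp only:)
  have "(\<lambda>x. LEAST j. j \<ge> 1 \<and> ?A j x = ?A (j - 1) x) \<in> measurable S (count_space UNIV)"
    using eq by (intro measurable_Least) (auto simp: pred_def)
  then have "(\<lambda>x. ?A (LEAST j. j \<ge> 1 \<and> ?A j x = ?A (j - 1) x) x)
      \<in> measurable S (count_space (Pow {1..m}))"
    by (intro measurable_compose_countable[OF iter])
  then show ?thesis by (simp add: step_down_def[abs_def])
qed

section \<open>Calibration and the step-down iteration\<close>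

text \<open>The event that \<open>\<lambda>\<close>-calibration bounds, seen in terms of the reference family at a fixed
  set \<open>A\<close>: it says that some \<open>R\<^sub>k\<close> contains at least \<open>k\<close> elements of \<open>A\<close>.\<close>

lemma INF_gen_inverse_less_iff:
  assumes t: "template S K t" and x: "x \<in> space S"
    and A: "A \<subseteq> {1..m}" and p: "\<And>i. i \<in> A \<Longrightarrow> 0 \<le> p i x" and l: "l x \<in> {0..1}"
  shows "(INF k\<in>{1..min K (card A)}.
      ereal (gen_inverse (\<lambda>u. t k u x) (kth_smallest k A (\<lambda>i. p i x)))) < ereal (l x)
    \<longleftrightarrow> \<not> (\<forall>k\<in>{1..K}. card (reference_family m p t l k x \<inter> A) \<le> k - 1)"
proof -
  have fin: "finite A" using A finite_subset by blast
  have inter: "reference_family m p t l k x \<inter> A = {i \<in> A. p i x < t k (l x) x}" for k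
    using A by (auto simp: reference_family_def)
  have "ereal (gen_inverse (\<lambda>u. t k u x) (kth_smallest k A (\<lambda>i. p i x))) < ereal (l x)
      \<longleftrightarrow> k \<le> card (reference_family m p t l k x \<inter> A)" if k: "k \<in> {1..min K (card A)}" for k
  proof -
    have "0 \<le> kth_smallest k A (\<lambda>i. p i x)"
      using k by (intro kth_smallest_nonneg fin p) auto
    then have "gen_inverse (\<lambda>u. t k u x) (kth_smallest k A (\<lambda>i. p i x)) < l x
        \<longleftrightarrow> kth_smallest k A (\<lambda>i. p i x) < t k (l x) x"
      using k by (intro gen_inverse_less_iff[OF template_at[OF t _ x] _ l]) auto
    also have "\<dots> \<longleftrightarrow> k \<le> card (reference_family m p t l k x \<inter> A)"
      unfolding inter using k by (intro kth_smallest_less_iff fin) auto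
    finally show ?thesis by simp
  qed
  then have "(INF k\<in>{1..min K (card A)}.
      ereal (gen_inverse (\<lambda>u. t k u x) (kth_smallest k A (\<lambda>i. p i x)))) < ereal (l x)
    \<longleftrightarrow> (\<exists>k\<in>{1..min K (card A)}. k \<le> card (reference_family m p t l k x \<inter> A))"
    unfolding INF_less_iff by blast
  \<comment> \<open>The restriction \<open>k \<le> card A\<close> is automatic, since \<open>R\<^sub>k \<inter> A\<close> has at most \<open>card A\<close> elements.\<close>
  also have "\<dots> \<longleftrightarrow> (\<exists>k\<in>{1..K}. k \<le> card (reference_family m p t l k x \<inter> A))"
  proof -
    have "card (reference_family m p t l k x \<inter> A) \<le> card A" for k
      using fin by (intro card_mono) auto
    then have "k \<le> card A" if "k \<le> card (reference_family m p t l k x \<inter> A)" for k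
      using that le_trans by blast
    then show ?thesis by fastforce
  qed
  also have "\<dots> \<longleftrightarrow> \<not> (\<forall>k\<in>{1..K}. card (reference_family m p t l k x \<inter> A) \<le> k - 1)"
  proof -
    have "k \<le> c \<longleftrightarrow> \<not> c \<le> k - 1" if "k \<in> {1..K}" for k c :: nat
      using that by auto
    then show ?thesis by blast
  qed
  finally show ?thesis .
qed

lemma reference_family_mono:
  assumes "template S K t" "k \<in> {1..K}" "x \<in> space S"
    "l x \<in> {0..1}" "l' x \<in> {0..1}" "l x \<le> l' x"
  shows "reference_family m p t l k x \<subseteq> reference_family m p t l' k x"
  using mono_onD[OF template_at(1)[OF assms(1-3)] assms(4-6)]
  by (auto simp: reference_family_def)

text \<open>If \<open>R\<^sub>1\<close> at the parameter of \<open>A\<close> itself contains no element of \<open>A\<close>, then no iteration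
  discards an element of \<open>A\<close>: the iterates stay above \<open>A\<close>, so their parameters stay below that
  of \<open>A\<close>.\<close>

lemma subset_step_down_iter:
  assumes t: "template S K t" "1 \<le> K" and x: "x \<in> space S" and A: "A \<subseteq> {1..m}"
    and range: "\<And>B. B \<subseteq> {1..m} \<Longrightarrow> l B x \<in> {0..1}"
    and anti: "\<And>B. A \<subseteq> B \<Longrightarrow> B \<subseteq> {1..m} \<Longrightarrow> l B x \<le> l A x"
    and disj: "reference_family m p t (l A) 1 x \<inter> A = {}"
  shows "A \<subseteq> step_down_iter m p t l j x"
proof (induction j)
  case 0
  with A show ?case by simp
next
  case (Suc j)
  note sub = step_down_iter_subset[of m p t l j x]
  have "reference_family m p t (l (step_down_iter m p t l j x)) 1 x
      \<subseteq> reference_family m p t (l A) 1 x"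
    using t x by (intro reference_family_mono[OF t(1)] range[OF sub] range[OF A]
        anti[OF Suc sub]) auto
  with disj A show ?case by (force simp: reference_family_def)
qed

section \<open>Control of the joint error rate\<close>

theorem proposition5p5:
  fixes S :: "'x measure" and \<P> :: "'x measure set"
    and m K :: nat and H0 :: "nat \<Rightarrow> 'x measure set"
    and p :: "nat \<Rightarrow> 'x \<Rightarrow> real"
    and t :: "nat \<Rightarrow> real \<Rightarrow> 'x \<Rightarrow> real"
    and lam :: "real \<Rightarrow> nat set \<Rightarrow> 'x \<Rightarrow> real"
    and \<alpha> :: real
  assumes "statistical_model S \<P>"
    and "K \<in> {1..m}"
    and "\<And>i. i \<in> {1..m} \<Longrightarrow> H0 i \<subseteq> \<P>"
    and "\<And>i. i \<in> {1..m} \<Longrightarrow> p_value S (H0 i) (p i)"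
    and "template S K t"
    and "calibration S \<P> m H0 p K t lam"
    and "\<alpha> \<in> {0<..<1}"
  shows "\<forall>P\<in>\<P>.
    JER m H0 K (reference_family m p t (\<lambda>x. lam \<alpha> (step_down m p t (lam \<alpha>) x) x)) P \<le> \<alpha>"
proof
  fix P assume P: "P \<in> \<P>"
  interpret prob_space P using assms(1) P by (simp add: statistical_model_def)
  have sets: "sets P = sets S" using assms(1) P by (simp add: statistical_model_def)
  then have space: "space P = space S" by (rule sets_eq_imp_space_eq)
  note meas = calibration_measurable[OF assms(6,7)]
  note range = calibration_range[OF assms(6,7)]
  note anti = calibration_antimono[OF assms(6,7)]
  have K: "1 \<le> K" using assms(2) by simp
  define A where "A = true_nulls m H0 P"
  have A: "A \<subseteq> {1..m}" by (auto simp: A_def true_nulls_def)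
  define lhat where "lhat = (\<lambda>x. lam \<alpha> (step_down m p t (lam \<alpha>) x) x)"
  have lhat: "lhat \<in> borel_measurable S"
    unfolding lhat_def
    by (rule measurable_compose_countable'[OF meas measurable_step_down[OF assms(5) K assms(4)]])
      (use meas range in \<open>simp_all add: countable_finite\<close>)
  have lhat01: "lhat x \<in> {0..1}" if "x \<in> space S" for x
    unfolding lhat_def using range[OF step_down_subset that] .
  define good where
    "good l x \<longleftrightarrow> (\<forall>k\<in>{1..K}. card (reference_family m p t l k x \<inter> A) \<le> k - 1)" for l x
  \<comment> \<open>A non-measurable set has \<open>measure\<close> zero by convention, so both the comparison and the passage
    to complements below need this.\<close>
  have good_sets: "{x \<in> space P. good l x} \<in> events"
    if l: "l \<in> borel_measurable S" "\<And>x. x \<in> space S \<Longrightarrow> l x \<in> {0..1}" for l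
  proof -
    have "Measurable.pred S (\<lambda>x. card (reference_family m p t l k x \<inter> A) \<le> k - 1)"
      if "k \<in> {1..K}" for k
      by (rule measurable_compose[OF measurable_reference_family[OF assms(5) that assms(4) l]])
        simp_all
    then have "Measurable.pred S (good l)"
      unfolding good_def by (intro pred_intros_finite) auto
    then show ?thesis by (simp add: pred_def sets space)
  qed
  have "measure P {x \<in> space P. \<not> good (lam \<alpha> A) x} \<le> \<alpha>"
  proof -
    have "{x \<in> space P. \<not> good (lam \<alpha> A) x} =
      {x \<in> space P. (INF k\<in>{1..min K (card A)}.
          ereal (gen_inverse (\<lambda>u. t k u x) (kth_smallest k A (\<lambda>i. p i x)))) < ereal (lam \<alpha> A x)}"
    proof (rule Collect_cong, rule conj_cong[OF refl])
      fix x assume "x \<in> space P"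
      then have x: "x \<in> space S" by (simp add: space)
      have "0 \<le> p i x" if "i \<in> A" for i
        using assms(4)[of i] that A x by (auto simp: p_value_def)
      then show "\<not> good (lam \<alpha> A) x \<longleftrightarrow> (INF k\<in>{1..min K (card A)}.
          ereal (gen_inverse (\<lambda>u. t k u x) (kth_smallest k A (\<lambda>i. p i x)))) < ereal (lam \<alpha> A x)"
        unfolding good_def
        by (intro INF_gen_inverse_less_iff[where l = "lam \<alpha> A" and S = S, symmetric]
              assms(5) x A range[OF A x])
    qed
    with assms(6)[unfolded calibration_def, THEN conjunct2, THEN conjunct2, rule_format,
        OF assms(7) P]
    show ?thesis by (simp add: A_def)
  qed
  then have "1 - \<alpha> \<le> measure P {x \<in> space P. good (lam \<alpha> A) x}"
    using prob_neg[OF good_sets[OF meas[OF A] range[OF A]]] by simp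
  also have "\<dots> \<le> measure P {x \<in> space P. good lhat x}"
  proof (intro finite_measure_mono good_sets lhat lhat01 Collect_mono impI conjI)
    fix x assume asm: "x \<in> space P \<and> good (lam \<alpha> A) x"
    then have x: "x \<in> space S" by (simp add: space)
    have "card (reference_family m p t (lam \<alpha> A) 1 x \<inter> A) \<le> 1 - 1"
      using asm bspec[of "{1..K}" _ 1] K unfolding good_def by fastforce
    moreover have "finite A" using A finite_subset by blast
    ultimately have disj: "reference_family m p t (lam \<alpha> A) 1 x \<inter> A = {}" by simp
    have "A \<subseteq> step_down m p t (lam \<alpha>) x"
      unfolding step_down_def
      by (rule subset_step_down_iter[where l = "lam \<alpha>",
            OF assms(5) K x A range[OF _ x] anti[OF _ _ x] disj])
    then have le: "lhat x \<le> lam \<alpha> A x"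
      unfolding lhat_def by (rule anti[OF _ step_down_subset x])
    show "good lhat x"
      unfolding good_def
    proof
      fix k assume k: "k \<in> {1..K}"
      have "card (reference_family m p t lhat k x \<inter> A)
          \<le> card (reference_family m p t (lam \<alpha> A) k x \<inter> A)"
        using \<open>finite A\<close>
        by (intro card_mono Int_mono reference_family_mono[OF assms(5) k x] lhat01[OF x]
            range[OF A x] le) auto
      also have "\<dots> \<le> k - 1" using asm k by (auto simp: good_def)
      finally show "card (reference_family m p t lhat k x \<inter> A) \<le> k - 1" .
    qed
  qed auto
  finally show "JER m H0 K
      (reference_family m p t (\<lambda>x. lam \<alpha> (step_down m p t (lam \<alpha>) x) x)) P \<le> \<alpha>"
    by (simp add: JER_def good_def A_def lhat_def)
qed

end
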